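(* $\mathbf{PAFKy}$ and $\mathbf{ELKy^r}$ are not equally expressive (over $\mathcal{S}5$ knowing-why models); in particular, there is a formula of $\mathcal{L}_{PAFKy}$ that is not equivalent to any formula of $\mathcal{L}_{ELKy^r}$.
   Context: Fix a countable set of agents $\mathcal{A}$ and a countably infinite set of atoms $\mathcal{P}$. $\mathcal{L}_{PAFKy}$: $\phi ::= p\mid\neg\phi\mid(\phi\land\phi)\mid K_a\phi\mid Ky_a\phi\mid[\phi]\phi$; $\mathcal{L}_{ELKy^r}$: $\phi ::= p\mid\neg\phi\mid(\phi\land\phi)\mid K_a\phi\mid Ky_a^r(\phi,\phi)$. Let $\mathcal{L}$ be the set of formulas built with all these constructs. $\Lambda$ is a fixed set of valid formulas (tautology ground). An $\mathcal{S}5$ knowing-why model is $\mathfrak{M}=\langle W,E,\{R_a\}_{a\in\mathcal{A}},\mathcal{E},V\rangle$ with $W\neq\emptyset$; $E$ nonempty, containing a designated $e$, closed under a binary operation $\cdot$; each $R_a$ an equivalence relation on $W$; $\mathcal{E}:E\times\mathcal{L}\to 2^W$ with $\mathcal{E}(e,\phi)=W$ for $\phi\in\Lambda$ and $\mathcal{E}(s,\phi\to\psi)\cap\mathcal{E}(t,\phi)\subseteq\mathcal{E}(s\cdot t,\psi)$; $V:\mathcal{P}\to 2^W$. Truth: $p,\neg,\land$ as usual; $K_a\phi$ holds at $w$ iff $\phi$ holds at all $R_a$-successors; $Ky_a\phi$ holds at $w$ iff $K_a\phi$ holds at $w$ and there is $t\in E$ with $v\in\mathcal{E}(t,\phi)$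 for all $R_a$-successors $v$; $Ky_a^r(\phi,\psi)$ holds at $w$ iff there is $t\in E$ such that every $v$ with $(w,v)\in R_a$ and $(\mathfrak{M},v)\models\phi$ satisfies $v\in\mathcal{E}(t,\psi)$ and $(\mathfrak{M},v)\models\psi$; $(\mathfrak{M},w)\models[\phi]\psi$ iff $(\mathfrak{M},w)\models\phi$ implies $(\mathfrak{M}|\phi,w)\models\psi$, where $\mathfrak{M}|\phi$ restricts $W$ to $W'=\{w\mid(\mathfrak{M},w)\models\phi\}$, $R_a$ to $R_a\cap(W'\times W')$, $V(p)$ to $V(p)\cap W'$ and $\mathcal{E}(t,\chi)$ to $\mathcal{E}(t,\chi)\cap W'$, keeping $E$. Two formulas are equivalent if they hold at exactly the same pointed models. Two logics are equally expressive if every formula of each is equivalent to some formula of the other. *)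

theory Defs
  imports
    "HOL-Library.Countable"
    "HOL-Library.Infinite_Typeclass"
begin

text \<open>
  Agents and atoms are the elements of the types \<open>'a\<close> and \<open>'p\<close>; the full language is the
  whole type \<open>('a, 'p) fm\<close>.
\<close>

datatype ('a, 'p) fm =
    Atom 'p
  | Neg "('a, 'p) fm"
  | Conj "('a, 'p) fm" "('a, 'p) fm"
  | K 'a "('a, 'p) fm"
  | Ky 'a "('a, 'p) fm"
  | KyR 'a "('a, 'p) fm" "('a, 'p) fm"
  | Ann "('a, 'p) fm" "('a, 'p) fm"

abbreviation Imp :: "('a, 'p) fm \<Rightarrow> ('a, 'p) fm \<Rightarrow> ('a, 'p) fm" where
  "Imp \<phi> \<psi> \<equiv> Neg (Conj \<phi> (Neg \<psi>))"

inductive_set L_PAFKy :: "('a, 'p) fm set" where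
  "Atom p \<in> L_PAFKy"
| "\<phi> \<in> L_PAFKy \<Longrightarrow> Neg \<phi> \<in> L_PAFKy"
| "\<phi> \<in> L_PAFKy \<Longrightarrow> \<psi> \<in> L_PAFKy \<Longrightarrow> Conj \<phi> \<psi> \<in> L_PAFKy"
| "\<phi> \<in> L_PAFKy \<Longrightarrow> K a \<phi> \<in> L_PAFKy"
| "\<phi> \<in> L_PAFKy \<Longrightarrow> Ky a \<phi> \<in> L_PAFKy"
| "\<phi> \<in> L_PAFKy \<Longrightarrow> \<psi> \<in> L_PAFKy \<Longrightarrow> Ann \<phi> \<psi> \<in> L_PAFKy"

inductive_set L_ELKyR :: "('a, 'p) fm set" where
  "Atom p \<in> L_ELKyR"
| "\<phi> \<in> L_ELKyR \<Longrightarrow> Neg \<phi> \<in> L_ELKyR"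
| "\<phi> \<in> L_ELKyR \<Longrightarrow> \<psi> \<in> L_ELKyR \<Longrightarrow> Conj \<phi> \<psi> \<in> L_ELKyR"
| "\<phi> \<in> L_ELKyR \<Longrightarrow> K a \<phi> \<in> L_ELKyR"
| "\<phi> \<in> L_ELKyR \<Longrightarrow> \<psi> \<in> L_ELKyR \<Longrightarrow> KyR a \<phi> \<psi> \<in> L_ELKyR"

record ('w, 'e, 'a, 'p) model =
  worlds :: "'w set"
  expls :: "'e set"
  unit_expl :: 'e
  app :: "'e \<Rightarrow> 'e \<Rightarrow> 'e"
  acc :: "'a \<Rightarrow> ('w \<times> 'w) set"
  adm :: "'e \<Rightarrow> ('a, 'p) fm \<Rightarrow> 'w set"
  val :: "'p \<Rightarrow> 'w set"

text \<open>
  The carriers \<open>worlds\<close> and \<open>expls\<close> are arbitrary subsets of \<open>'w\<close> and \<open>'e\<close>. For countable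
  \<open>'a\<close> and \<open>'p\<close>, validity and equivalence over models of any cardinality are determined by
  models with countable carriers (Skolem hulls), so any infinite \<open>'w\<close> and \<open>'e\<close> yield the
  absolute notions.
\<close>

definition S5_models :: "('a, 'p) fm set \<Rightarrow> ('w, 'e, 'a, 'p) model set" where
  "S5_models \<Lambda> = {M.
     worlds M \<noteq> {} \<and>
     unit_expl M \<in> expls M \<and>
     (\<forall>s\<in>expls M. \<forall>t\<in>expls M. app M s t \<in> expls M) \<and>
     (\<forall>a. equiv (worlds M) (acc M a)) \<and>
     (\<forall>t\<in>expls M. \<forall>\<phi>. adm M t \<phi> \<subseteq> worlds M) \<and>
     (\<forall>\<phi>\<in>\<Lambda>. adm M (unit_expl M) \<phi> = worlds M) \<and>
     (\<forall>s\<in>expls M. \<forall>t\<in>expls M. \<forall>\<phi> \<psi>.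
        adm M s (Imp \<phi> \<psi>) \<inter> adm M t \<phi> \<subseteq> adm M (app M s t) \<psi>) \<and>
     (\<forall>p. val M p \<subseteq> worlds M)}"

definition restrict_model ::
    "('w, 'e, 'a, 'p) model \<Rightarrow> 'w set \<Rightarrow> ('w, 'e, 'a, 'p) model" where
  "restrict_model M W' = M\<lparr>
     worlds := W',
     acc := (\<lambda>a. acc M a \<inter> W' \<times> W'),
     adm := (\<lambda>t \<chi>. adm M t \<chi> \<inter> W'),
     val := (\<lambda>p. val M p \<inter> W')\<rparr>"

primrec sat :: "('a, 'p) fm \<Rightarrow> ('w, 'e, 'a, 'p) model \<Rightarrow> 'w \<Rightarrow> bool" where
  "sat (Atom p) M w \<longleftrightarrow> w \<in> val M p"
| "sat (Neg \<phi>) M w \<longleftrightarrow> \<not> sat \<phi> M w"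
| "sat (Conj \<phi> \<psi>) M w \<longleftrightarrow> sat \<phi> M w \<and> sat \<psi> M w"
| "sat (K a \<phi>) M w \<longleftrightarrow> (\<forall>v. (w, v) \<in> acc M a \<longrightarrow> sat \<phi> M v)"
| "sat (Ky a \<phi>) M w \<longleftrightarrow>
     (\<forall>v. (w, v) \<in> acc M a \<longrightarrow> sat \<phi> M v) \<and>
     (\<exists>t\<in>expls M. \<forall>v. (w, v) \<in> acc M a \<longrightarrow> v \<in> adm M t \<phi>)"
| "sat (KyR a \<phi> \<psi>) M w \<longleftrightarrow>
     (\<exists>t\<in>expls M. \<forall>v. (w, v) \<in> acc M a \<and> sat \<phi> M v \<longrightarrow>
        v \<in> adm M t \<psi> \<and> sat \<psi> M v)"
| "sat (Ann \<phi> \<psi>) M w \<longleftrightarrow>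
     (sat \<phi> M w \<longrightarrow> sat \<psi> (restrict_model M {v \<in> worlds M. sat \<phi> M v}) w)"

definition valid_over :: "('w, 'e, 'a, 'p) model set \<Rightarrow> ('a, 'p) fm \<Rightarrow> bool" where
  "valid_over C \<phi> \<longleftrightarrow> (\<forall>M\<in>C. \<forall>w\<in>worlds M. sat \<phi> M w)"

definition equivalent_over ::
    "('w, 'e, 'a, 'p) model set \<Rightarrow> ('a, 'p) fm \<Rightarrow> ('a, 'p) fm \<Rightarrow> bool" where
  "equivalent_over C \<phi> \<psi> \<longleftrightarrow> (\<forall>M\<in>C. \<forall>w\<in>worlds M. sat \<phi> M w \<longleftrightarrow> sat \<psi> M w)"

definition equally_expressive_over ::
    "('w, 'e, 'a, 'p) model set \<Rightarrow> ('a, 'p) fm set \<Rightarrow> ('a, 'p) fm set \<Rightarrow> bool" where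
  "equally_expressive_over C L1 L2 \<longleftrightarrow>
     (\<forall>\<phi>\<in>L1. \<exists>\<psi>\<in>L2. equivalent_over C \<phi> \<psi>) \<and>
     (\<forall>\<psi>\<in>L2. \<exists>\<phi>\<in>L1. equivalent_over C \<psi> \<phi>)"

end

theory Submission
  imports Defs
begin

text \<open>
  The witness is \<open>[p] Ky\<^sub>a K\<^sub>a p\<close>. Take two mutually accessible worlds, with \<open>p\<close> true at exactly
  one of them, and a single explanation \<open>e\<close>. In the model \<open>M\<close> let \<open>e\<close> explain every formula at
  every world; in the model \<open>N\<close> let \<open>e\<close> explain at a world exactly the formulas true there
  in \<open>M\<close>. Truth is closed under modus ponens and \<open>\<Lambda>\<close> is valid, so \<open>N\<close> is a knowing-why model.
  Since \<open>Ky\<^sup>r\<close> asks for explanations of \<open>\<psi>\<close> only at worlds where \<open>\<psi>\<close> is true, \<open>M\<close> and \<open>N\<close> satisfy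
  the same formulas of \<open>ELKy\<^sup>r\<close>. But \<open>K\<^sub>a p\<close> is false throughout \<open>M\<close>, hence unexplained in \<open>N\<close>,
  while the announcement of \<open>p\<close> makes it true: the witness holds in \<open>M\<close> and fails in \<open>N\<close>.
\<close>

definition uniform_model ::
    "'w set \<Rightarrow> 'e \<Rightarrow> (('a, 'p) fm \<Rightarrow> 'w set) \<Rightarrow> 'w set \<Rightarrow> ('w, 'e, 'a, 'p) model" where
  "uniform_model W e A P =
     \<lparr>worlds = W, expls = {e}, unit_expl = e, app = (\<lambda>_ _. e), acc = (\<lambda>_. W \<times> W),
      adm = (\<lambda>_. A), val = (\<lambda>_. P)\<rparr>"

lemma uniform_model_in_S5_models_iff:
  "uniform_model W e A P \<in> S5_models \<Lambda> \<longleftrightarrow>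
     W \<noteq> {} \<and> P \<subseteq> W \<and> (\<forall>\<phi>. A \<phi> \<subseteq> W) \<and> (\<forall>\<phi>\<in>\<Lambda>. A \<phi> = W) \<and>
     (\<forall>\<phi> \<psi>. A (Imp \<phi> \<psi>) \<inter> A \<phi> \<subseteq> A \<psi>)"
  by (auto simp: uniform_model_def S5_models_def equiv_def refl_on_def sym_def trans_def)

lemma sat_uniform_model_truth_set:
  fixes W P :: "'w set" and e :: 'e
  defines "M \<equiv> uniform_model W e (\<lambda>_. W) P"
  defines "N \<equiv> uniform_model W e (\<lambda>\<phi>. {v \<in> W. sat \<phi> M v}) P"
  assumes "\<phi> \<in> L_ELKyR" and "w \<in> W"
  shows "sat \<phi> N w \<longleftrightarrow> sat \<phi> M w"
  using assms(3,4)
proof (induction arbitrary: w)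
  case (5 \<phi> \<psi> a)
  \<comment> \<open>In both models the sole explanation \<open>e\<close> covers
    \<open>\<psi>\<close> wherever \<open>\<psi>\<close> is true, so the explanation clause drops
    out.\<close>
  have "sat (KyR a \<phi> \<psi>) N w \<longleftrightarrow> (\<forall>v\<in>W. sat \<phi> M v \<longrightarrow> sat \<psi> M v)"
    using 5 by (auto simp: N_def uniform_model_def)
  also have "\<dots> \<longleftrightarrow> sat (KyR a \<phi> \<psi>) M w"
    using 5 by (auto simp: M_def uniform_model_def)
  finally show ?case .
qed (auto simp: M_def N_def uniform_model_def)

text \<open>Only the worlds of \<open>P\<close> survive the announcement, so
  \<open>K a (Atom p)\<close> becomes trivially true; what remains is the explanation clause, still
  governed by the original \<open>A\<close>.\<close>

lemma sat_Ann_Ky_K_uniform_model: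
  assumes "P \<subseteq> W" and "w \<in> P"
  shows "sat (Ann (Atom p) (Ky a (K a (Atom p)))) (uniform_model W e A P) w \<longleftrightarrow>
    P \<subseteq> A (K a (Atom p))"
  using assms by (auto simp: uniform_model_def restrict_model_def)

theorem theorem4p5:
  fixes \<Lambda> :: "('a::countable, 'p::{countable, infinite}) fm set"
    and C :: "('w::infinite, 'e::infinite, 'a, 'p) model set"
  assumes "C = S5_models \<Lambda>"
    and "\<forall>\<phi>\<in>\<Lambda>. valid_over C \<phi>"
  shows "\<not> equally_expressive_over C L_PAFKy L_ELKyR \<and>
    (\<exists>\<phi>\<in>L_PAFKy. \<forall>\<psi>\<in>L_ELKyR. \<not> equivalent_over C \<phi> \<psi>)"
proof -
  obtain w u :: 'w where "w \<noteq> u"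
    by (metis ex_new_if_finite finite.emptyI finite_insert infinite_UNIV insertI1)
  fix a :: 'a and p :: 'p and e :: 'e
  define W where "W = {w, u}"
  define M where "M = (uniform_model W e (\<lambda>_. W) {w} :: ('w, 'e, 'a, 'p) model)"
  define N where "N = (uniform_model W e (\<lambda>\<phi>. {v \<in> W. sat \<phi> M v}) {w} :: ('w, 'e, 'a, 'p) model)"
  define \<chi> where "\<chi> = (Ann (Atom p) (Ky a (K a (Atom p))) :: ('a, 'p) fm)"
  have M: "M \<in> C"
    unfolding assms(1) M_def uniform_model_in_S5_models_iff by (auto simp: W_def)
  have "worlds M = W" and "worlds N = W"
    by (simp_all add: M_def N_def uniform_model_def)
  then have "sat \<phi> M v" if "\<phi> \<in> \<Lambda>" "v \<in> W" for \<phi> v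
    using assms(2) M that by (auto simp: valid_over_def)
  then have N: "N \<in> C"
    unfolding assms(1) N_def uniform_model_in_S5_models_iff by (auto simp: W_def)
  have "sat \<chi> M w"
    unfolding \<chi>_def M_def by (subst sat_Ann_Ky_K_uniform_model) (auto simp: W_def)
  \<comment> \<open>The accessible world \<open>u\<close> refutes \<open>p\<close>.\<close>
  moreover have "\<not> sat (K a (Atom p)) M w"
    using \<open>w \<noteq> u\<close> by (auto simp: M_def W_def uniform_model_def)
  then have "\<not> sat \<chi> N w"
    unfolding \<chi>_def N_def by (subst sat_Ann_Ky_K_uniform_model) (auto simp: W_def)
  moreover have "sat \<psi> N w \<longleftrightarrow> sat \<psi> M w" if "\<psi> \<in> L_ELKyR" for \<psi>
    unfolding N_def M_def
    by (rule sat_uniform_model_truth_set) (use that in \<open>auto simp: W_def\<close>)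
  ultimately have "\<not> equivalent_over C \<chi> \<psi>" if "\<psi> \<in> L_ELKyR" for \<psi>
    using M N that \<open>worlds M = W\<close> \<open>worlds N = W\<close>
    unfolding equivalent_over_def W_def by blast
  moreover have "\<chi> \<in> L_PAFKy"
    unfolding \<chi>_def by (intro L_PAFKy.intros)
  ultimately show ?thesis
    unfolding equally_expressive_over_def by blast
qed

end
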